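(* Let $L\in\mathbb{Z}_{\ge2}$ and $P,N>0$ with $N\le\frac{L-1}{L}P$. Then $$\overline{C}_{L-1}(P,N)\ge\frac12\ln\frac{(L-1)^2P^2}{LN\left(2(L-1)P-LN\right)}.$$
   Context: $\mathcal{B}^n(r)$ is the closed Euclidean ball of radius $r$ centered at the origin. For $x_1,\dots,x_L\in\mathbb{R}^n$ with centroid $\bar x=\frac1L\sum_ix_i$, $\overline{\mathrm{rad}}^2(x_1,\dots,x_L)=\frac1L\sum_i\|x_i-\bar x\|_2^2$. A finite $\mathcal{C}\subseteq\mathcal{B}^n(\sqrt{nP})$ is $(P,N,L-1)$-average-radius list-decodable if every $L$ distinct points of $\mathcal{C}$ have $\overline{\mathrm{rad}}^2>nN$. Rate $R(\mathcal{C})=\frac1n\ln|\mathcal{C}|$. $\overline{C}_{L-1}(P,N)=\limsup_{n\to\infty}\sup R(\mathcal{C})$ over such codes in $\mathcal{B}^n(\sqrt{nP})$. *)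

theory Defs
  imports "HOL-Analysis.Analysis" "HOL-Library.Liminf_Limsup"
begin

text \<open>Vectors of R^n are represented as functions nat => real supported on {..<n}.\<close>

definition in_ball :: "nat \<Rightarrow> real \<Rightarrow> (nat \<Rightarrow> real) \<Rightarrow> bool" where
  "in_ball n r x \<longleftrightarrow> (\<forall>i\<ge>n. x i = 0) \<and> (\<Sum>i<n. (x i)\<^sup>2) \<le> r\<^sup>2"

definition centroid :: "(nat \<Rightarrow> real) set \<Rightarrow> (nat \<Rightarrow> real)" where
  "centroid S = (\<lambda>i. (\<Sum>x\<in>S. x i) / real (card S))"

definition avg_rad_sq :: "nat \<Rightarrow> (nat \<Rightarrow> real) set \<Rightarrow> real" where
  "avg_rad_sq n S = (\<Sum>x\<in>S. \<Sum>i<n. (x i - centroid S i)\<^sup>2) / real (card S)"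

definition avg_radius_list_decodable ::
  "nat \<Rightarrow> real \<Rightarrow> real \<Rightarrow> nat \<Rightarrow> (nat \<Rightarrow> real) set \<Rightarrow> bool" where
  "avg_radius_list_decodable n P N L C \<longleftrightarrow>
     finite C \<and> (\<forall>x\<in>C. in_ball n (sqrt (real n * P)) x) \<and>
     (\<forall>S\<subseteq>C. card S = L \<longrightarrow> avg_rad_sq n S > real n * N)"

definition code_rate :: "nat \<Rightarrow> (nat \<Rightarrow> real) set \<Rightarrow> real" where
  "code_rate n C = ln (real (card C)) / real n"

definition list_dec_capacity :: "nat \<Rightarrow> real \<Rightarrow> real \<Rightarrow> ereal" where
  "list_dec_capacity L P N =
     limsup (\<lambda>n. SUP C\<in>{C. C \<noteq> {} \<and> avg_radius_list_decodable n P N L C}.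
                    ereal (code_rate n C))"

end

theory Submission
  imports Defs
begin

text \<open>
  For points on the sphere of radius \<open>sqrt (n P)\<close>, the average squared radius of an \<open>L\<close>-set
  is determined by the sum of the pairwise inner products. It exceeds \<open>n N\<close> as soon as every
  pairwise inner product is below \<open>c n P\<close>, where \<open>c = 1 - L N / ((L - 1) P)\<close>, so a spherical code
  with angle \<open>arccos c\<close> suffices, and the claimed rate is its Gilbert--Varshamov rate
  \<open>- ln (sqrt (1 - c\<^sup>2))\<close>. For the latter, scale the sphere to radius \<open>1\<close>: a vector of norm
  in \<open>(1 - \<delta>, 1]\<close> whose angle with a codeword \<open>x\<close> is at most \<open>arccos c\<close> lies in the ball of
  squared radius \<open>1 - c\<^sup>2 + \<delta>\<close> around \<open>c x\<close>. Comparing volumes, as long as the code is small some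
  vector of the shell avoids all these balls, and its projection to the sphere extends the code.
\<close>

section \<open>Volumes of balls\<close>

text \<open>A product measure is determined by its values on boxes, and each factor
  \<open>lborel\<close> is invariant under translation. This lets balls with arbitrary centers be
  moved to the origin.\<close>

lemma distr_PiM_lborel_translate:
  fixes c :: "'i \<Rightarrow> real"
  assumes [simp]: "finite I"
  shows "distr (Pi\<^sub>M I (\<lambda>_. lborel)) (Pi\<^sub>M I (\<lambda>_. lborel)) (\<lambda>f. \<lambda>i\<in>I. c i + f i)
           = Pi\<^sub>M I (\<lambda>_. lborel)"
proof -
  interpret product_sigma_finite "\<lambda>_::'i. lborel :: real measure"
    by unfold_locales
  have meas: "(\<lambda>f. \<lambda>i\<in>I. c i + f i) \<in> Pi\<^sub>M I (\<lambda>_. lborel) \<rightarrow>\<^sub>M Pi\<^sub>M I (\<lambda>_. lborel :: real measure)"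
    by (intro measurable_restrict borel_measurable_add measurable_component_singleton) auto
  show ?thesis
  proof (rule PiM_eqI)
    fix A :: "'i \<Rightarrow> real set"
    assume A: "\<And>i. i \<in> I \<Longrightarrow> A i \<in> sets lborel"
    have eq: "(\<lambda>f. \<lambda>i\<in>I. c i + f i) -` Pi\<^sub>E I A \<inter> space (Pi\<^sub>M I (\<lambda>_. lborel))
                = Pi\<^sub>E I (\<lambda>i. (+) (c i) -` A i)"
      by (auto simp: space_PiM PiE_iff)
    have pre: "(+) (c i) -` A i \<in> sets lborel" if "i \<in> I" for i
      using A[OF that] measurable_sets[of "(+) (c i)" borel borel "A i"] by simp
    have "emeasure lborel ((+) (c i) -` A i) = emeasure lborel (A i)" if "i \<in> I" for i
    proof -
      have "emeasure lborel (A i) = emeasure (distr lborel borel ((+) (c i))) (A i)"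
        by (simp add: lborel_distr_plus)
      also have "\<dots> = emeasure lborel ((+) (c i) -` A i)"
        using A[OF that] by (subst emeasure_distr) auto
      finally show ?thesis ..
    qed
    then show "emeasure (distr (Pi\<^sub>M I (\<lambda>_. lborel)) (Pi\<^sub>M I (\<lambda>_. lborel))
                 (\<lambda>f. \<lambda>i\<in>I. c i + f i)) (Pi\<^sub>E I A) = (\<Prod>i\<in>I. emeasure lborel (A i))"
      using A pre
      by (subst emeasure_distr[OF meas]) (auto simp: eq emeasure_PiM intro!: sets_PiM_I_finite)
  qed auto
qed

text \<open>The ball lives in the product space of \<open>lborel\<close> over \<open>I\<close>, not
  in a Euclidean type, so that the dimension can be a variable.\<close>

definition PiM_cball :: "'i set \<Rightarrow> ('i \<Rightarrow> real) \<Rightarrow> real \<Rightarrow> ('i \<Rightarrow> real) set" where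
  "PiM_cball I c r =
     {f \<in> space (Pi\<^sub>M I (\<lambda>_. lborel :: real measure)). (\<Sum>i\<in>I. (f i - c i)\<^sup>2) \<le> r\<^sup>2}"

lemma sets_PiM_cball: "PiM_cball I c r \<in> sets (Pi\<^sub>M I (\<lambda>_. lborel))"
proof -
  have "(\<lambda>f. \<Sum>i\<in>I. (f i - c i)\<^sup>2) \<in> borel_measurable (Pi\<^sub>M I (\<lambda>_. lborel :: real measure))"
    by (intro borel_measurable_sum borel_measurable_power borel_measurable_diff
        borel_measurable_const) measurable
  then show ?thesis
    unfolding PiM_cball_def by measurable
qed

text \<open>Translating by \<open>c\<close> reduces the claim to center 0, where
  \<open>emeasure_cball_aux\<close> gives the volume.\<close>

lemma emeasure_PiM_cball:
  assumes [simp]: "finite I" and r: "r > 0"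
  shows "emeasure (Pi\<^sub>M I (\<lambda>_. lborel)) (PiM_cball I c r)
           = ennreal (unit_ball_vol (real (card I)) * r ^ card I)"
proof -
  let ?M = "Pi\<^sub>M I (\<lambda>_. lborel :: real measure)"
  let ?T = "\<lambda>f. \<lambda>i\<in>I. c i + f i"
  have meas: "?T \<in> ?M \<rightarrow>\<^sub>M ?M"
    by (intro measurable_restrict borel_measurable_add measurable_component_singleton) auto
  have "emeasure ?M (PiM_cball I c r) = emeasure (distr ?M ?M ?T) (PiM_cball I c r)"
    by (simp add: distr_PiM_lborel_translate)
  also have "\<dots> = emeasure ?M (?T -` PiM_cball I c r \<inter> space ?M)"
    by (rule emeasure_distr[OF meas sets_PiM_cball])
  also have "?T -` PiM_cball I c r \<inter> space ?M = {f. sqrt (\<Sum>i\<in>I. (f i)\<^sup>2) \<le> r} \<inter> space ?M"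
  proof -
    have "sqrt s \<le> r \<longleftrightarrow> s \<le> r\<^sup>2" for s
      using r by (metis less_imp_le real_sqrt_le_iff real_sqrt_unique)
    then show ?thesis
      by (auto simp: PiM_cball_def space_PiM)
  qed
  also have "emeasure ?M \<dots> = ennreal (unit_ball_vol (real (card I)) * r ^ card I)"
    by (rule emeasure_cball_aux) (use r in auto)
  finally show ?thesis .
qed

text \<open>Union bound: the common factor \<open>unit_ball_vol n\<close> cancels, so balls with too
  small a sum of \<open>r j ^ n\<close> cannot cover the ball of radius \<open>R\<close>. The radii
  may differ, so that the inner ball of a shell can be one of the balls to avoid.\<close>

lemma exists_point_avoiding_balls:
  fixes c :: "'j \<Rightarrow> nat \<Rightarrow> real" and r :: "'j \<Rightarrow> real"
  assumes J: "finite J" and R: "R > 0" and r: "\<And>j. j \<in> J \<Longrightarrow> r j > 0"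
    and vol: "(\<Sum>j\<in>J. r j ^ n) < R ^ n"
  obtains y where "(\<Sum>i<n. (y i)\<^sup>2) \<le> R\<^sup>2"
    and "\<And>j. j \<in> J \<Longrightarrow> (r j)\<^sup>2 < (\<Sum>i<n. (y i - c j i)\<^sup>2)"
proof -
  let ?M = "Pi\<^sub>M {..<n} (\<lambda>_. lborel :: real measure)"
  let ?v = "unit_ball_vol (real n)"
  have v: "?v > 0" by simp
  have "\<not> PiM_cball {..<n} (\<lambda>_. 0) R \<subseteq> (\<Union>j\<in>J. PiM_cball {..<n} (c j) (r j))"
  proof
    assume sub: "PiM_cball {..<n} (\<lambda>_. 0) R \<subseteq> (\<Union>j\<in>J. PiM_cball {..<n} (c j) (r j))"
    have "ennreal (?v * R ^ n) = emeasure ?M (PiM_cball {..<n} (\<lambda>_. 0) R)"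
      using R by (simp add: emeasure_PiM_cball)
    also have "\<dots> \<le> emeasure ?M (\<Union>j\<in>J. PiM_cball {..<n} (c j) (r j))"
      by (intro emeasure_mono[OF sub] sets.finite_UN J sets_PiM_cball)
    also have "\<dots> \<le> (\<Sum>j\<in>J. emeasure ?M (PiM_cball {..<n} (c j) (r j)))"
      by (intro emeasure_subadditive_finite J) (auto intro: sets_PiM_cball)
    also have "\<dots> = (\<Sum>j\<in>J. ennreal (?v * r j ^ n))"
      by (intro sum.cong refl) (simp add: emeasure_PiM_cball r)
    also have "\<dots> = ennreal (\<Sum>j\<in>J. ?v * r j ^ n)"
      by (intro sum_ennreal) (auto dest: r)
    also have "\<dots> = ennreal (?v * (\<Sum>j\<in>J. r j ^ n))"
      by (simp add: sum_distrib_left)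
    finally have "?v * R ^ n \<le> ?v * (\<Sum>j\<in>J. r j ^ n)"
      by (subst (asm) ennreal_le_iff)
         (auto intro!: mult_nonneg_nonneg sum_nonneg zero_le_power less_imp_le[OF r])
    with v vol show False by simp
  qed
  then show ?thesis
    by (force simp: PiM_cball_def not_le intro: that)
qed

section \<open>Spherical codes\<close>

text \<open>The parameter \<open>c\<close> is the cosine of an angle that all pairwise angles must
  exceed.\<close>

definition spherical_code :: "nat \<Rightarrow> real \<Rightarrow> real \<Rightarrow> (nat \<Rightarrow> real) set \<Rightarrow> bool" where
  "spherical_code n R c C \<longleftrightarrow> finite C
     \<and> (\<forall>x\<in>C. (\<forall>i\<ge>n. x i = 0) \<and> (\<Sum>i<n. (x i)\<^sup>2) = R\<^sup>2)
     \<and> (\<forall>x\<in>C. \<forall>y\<in>C. x \<noteq> y \<longrightarrow> (\<Sum>i<n. x i * y i) < c * R\<^sup>2)"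

lemma spherical_code_extend:
  assumes C: "spherical_code n R c C" and R: "R > 0" and c: "0 \<le> c" "c < 1"
    and \<delta>: "0 < \<delta>" "\<delta> < 1"
    and vol: "real (card C) * sqrt (1 - c\<^sup>2 + \<delta>) ^ n + (1 - \<delta>) ^ n < 1"
  shows "\<exists>C'. spherical_code n R c C' \<and> card C' = Suc (card C)"
proof -
  define \<rho> where "\<rho> = sqrt (1 - c\<^sup>2 + \<delta>)"
  have c2: "c\<^sup>2 < 1" using c by (simp add: power_less_one_iff)
  have \<rho>: "\<rho> > 0" "\<rho>\<^sup>2 = 1 - c\<^sup>2 + \<delta>"
    using c2 \<delta> by (simp_all add: \<rho>_def)
  have fin: "finite C" using C by (simp add: spherical_code_def)
  \<comment> \<open>The index \<open>None\<close> stands for the inner ball, whose removal leaves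
    the shell; \<open>Some x\<close> stands for the ball around \<open>c * x\<close>.\<close>
  define J where "J = insert None (Some ` C)"
  define r where "r j = (case j of None \<Rightarrow> (1 - \<delta>) * R | Some x \<Rightarrow> \<rho> * R)"
    for j :: "(nat \<Rightarrow> real) option"
  define ctr where "ctr j = (case j of None \<Rightarrow> (\<lambda>i. 0) | Some x \<Rightarrow> (\<lambda>i. c * x i))"
    for j :: "(nat \<Rightarrow> real) option"
  have "(\<Sum>j\<in>J. r j ^ n) = ((1 - \<delta>) * R) ^ n + real (card C) * (\<rho> * R) ^ n"
    using fin by (simp add: J_def r_def sum.reindex)
  also have "\<dots> = (real (card C) * \<rho> ^ n + (1 - \<delta>) ^ n) * R ^ n"
    by (simp only: power_mult_distrib distrib_right mult.assoc add.commute)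
  also have "\<dots> < 1 * R ^ n"
    using vol R by (intro mult_strict_right_mono) (auto simp: \<rho>_def)
  finally have "(\<Sum>j\<in>J. r j ^ n) < R ^ n" by simp
  moreover have "r j > 0" if "j \<in> J" for j
    using \<rho> R \<delta> by (simp add: r_def split: option.split)
  moreover have "finite J" using fin by (simp add: J_def)
  ultimately obtain y where y: "(\<Sum>i<n. (y i)\<^sup>2) \<le> R\<^sup>2"
    and avoid: "\<And>j. j \<in> J \<Longrightarrow> (r j)\<^sup>2 < (\<Sum>i<n. (y i - ctr j i)\<^sup>2)"
    using exists_point_avoiding_balls[of J R r n ctr] R by blast
  have y_gt: "((1 - \<delta>) * R)\<^sup>2 < (\<Sum>i<n. (y i)\<^sup>2)"
    using avoid[of None] by (simp add: J_def r_def ctr_def)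
  have far: "\<rho>\<^sup>2 * R\<^sup>2 < (\<Sum>i<n. (y i - c * x i)\<^sup>2)" if "x \<in> C" for x
    using avoid[of "Some x"] that by (simp add: J_def r_def ctr_def power_mult_distrib)
  define t where "t = sqrt (\<Sum>i<n. (y i)\<^sup>2) / R"
  have t2: "(\<Sum>i<n. (y i)\<^sup>2) = t\<^sup>2 * R\<^sup>2"
    using R by (simp add: t_def power_divide sum_nonneg)
  have t_nonneg: "t \<ge> 0"
    using R by (simp add: t_def sum_nonneg)
  have "t\<^sup>2 * R\<^sup>2 \<le> 1 * R\<^sup>2" "(1 - \<delta>)\<^sup>2 * R\<^sup>2 < t\<^sup>2 * R\<^sup>2"
    using y y_gt by (simp_all add: t2 power_mult_distrib)
  then have "t\<^sup>2 \<le> 1" "(1 - \<delta>)\<^sup>2 < t\<^sup>2"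
    using R by simp_all
  then have t: "t \<le> 1" "1 - \<delta> < t"
    using t_nonneg power_less_imp_less_base[of "1 - \<delta>" 2 t]
    by (auto simp: power_le_one_iff)
  have t_pos: "t > 0" using t \<delta> by simp
  \<comment> \<open>The values of \<open>y\<close> at indices from \<open>n\<close> on are
    arbitrary, so the projection to the sphere sets them to 0.\<close>
  define z where "z i = (if i < n then y i / t else 0)" for i
  have z_norm: "(\<Sum>i<n. (z i)\<^sup>2) = R\<^sup>2"
    using t2 t_pos by (simp add: z_def power_divide flip: sum_divide_distrib)
  have z_inner: "(\<Sum>i<n. x i * z i) < c * R\<^sup>2" if x: "x \<in> C" for x
  proof (rule ccontr)
    assume "\<not> ?thesis"
    then have ge: "c * R\<^sup>2 \<le> (\<Sum>i<n. x i * z i)" by simp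
    have x_norm: "(\<Sum>i<n. (x i)\<^sup>2) = R\<^sup>2"
      using C x by (simp add: spherical_code_def)
    have "(\<Sum>i<n. (y i - c * x i)\<^sup>2)
        = (\<Sum>i<n. (y i)\<^sup>2 - 2 * c * t * (x i * z i) + c\<^sup>2 * (x i)\<^sup>2)"
      using t_pos by (intro sum.cong) (auto simp: z_def power2_eq_square algebra_simps)
    also have "\<dots> = t\<^sup>2 * R\<^sup>2 - 2 * c * t * (\<Sum>i<n. x i * z i) + c\<^sup>2 * R\<^sup>2"
      by (simp add: sum.distrib sum_subtractf t2 x_norm flip: sum_distrib_left)
    also have "\<dots> \<le> t\<^sup>2 * R\<^sup>2 - 2 * c * t * (c * R\<^sup>2) + c\<^sup>2 * R\<^sup>2"
      using mult_left_mono[OF ge, of "2 * c * t"] c t_pos by simp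
    \<comment> \<open>At \<open>t = 1\<close> the squared distance is at most
      \<open>(1 - c\<^sup>2) * R\<^sup>2\<close>. The factorization isolates the error of a shorter
      \<open>y\<close>: the first factor lies in \<open>[0, \<delta>)\<close> and the second is
      below 1.\<close>
    also have "\<dots> = (1 - c\<^sup>2 + (1 - t) * (2 * c\<^sup>2 - 1 - t)) * R\<^sup>2"
      by (simp add: algebra_simps power2_eq_square)
    also have "\<dots> \<le> (1 - c\<^sup>2 + \<delta>) * R\<^sup>2"
    proof -
      have "(1 - t) * (2 * c\<^sup>2 - 1 - t) \<le> (1 - t) * 1"
        using t c2 t_pos by (intro mult_left_mono) auto
      also have "\<dots> \<le> \<delta>" using t by simp
      finally show ?thesis by (intro mult_right_mono) auto
    qed
    finally show False using far[OF x] \<rho> by simp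
  qed
  \<comment> \<open>A codeword would have to satisfy the inner product bound with itself, which
    \<open>c < 1\<close> forbids. Hence the cardinality really grows.\<close>
  have "z \<notin> C"
  proof
    assume "z \<in> C"
    then have "R\<^sup>2 < c * R\<^sup>2"
      using z_inner[of z] z_norm by (simp add: power2_eq_square)
    then show False using c R by simp
  qed
  moreover have "spherical_code n R c (insert z C)"
    using C z_norm z_inner by (auto simp: spherical_code_def z_def mult.commute)
  ultimately show ?thesis
    using fin by (intro exI[of _ "insert z C"]) simp
qed

text \<open>Greedy construction: the inner ball takes at most half of the volume, so extension
  succeeds as long as the balls around the scaled codewords take less than the other half.\<close>

lemma exists_large_spherical_code:
  assumes R: "R > 0" and c: "0 \<le> c" "c < 1" and \<delta>: "0 < \<delta>" "\<delta> < 1"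
    and n: "(1 - \<delta>) ^ n \<le> 1 / 2"
  obtains C where "spherical_code n R c C"
    and "real (card C) \<ge> 1 / (2 * sqrt (1 - c\<^sup>2 + \<delta>) ^ n)"
proof -
  define \<rho> where "\<rho> = sqrt (1 - c\<^sup>2 + \<delta>)"
  have "c\<^sup>2 < 1" using c by (simp add: power_less_one_iff)
  then have \<rho>: "\<rho> ^ n > 0" using \<delta> by (simp add: \<rho>_def)
  define K where "K = nat \<lceil>1 / (2 * \<rho> ^ n)\<rceil>"
  have "\<exists>C. spherical_code n R c C \<and> card C = k" if "k \<le> K" for k
    using that
  proof (induction k)
    case 0
    show ?case by (intro exI[of _ "{}"]) (simp add: spherical_code_def)
  next
    case (Suc k)
    then obtain C where C: "spherical_code n R c C" "card C = k" by auto
    \<comment> \<open>Since \<open>K\<close> is a ceiling, \<open>Suc k \<le> K\<close> puts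
      \<open>k\<close> strictly below the number rounded up.\<close>
    have "real k < 1 / (2 * \<rho> ^ n)"
      using Suc.prems by (simp add: K_def) linarith
    then have "real k * \<rho> ^ n < 1 / 2"
      using \<rho> by (simp add: field_simps)
    then show ?case
      using spherical_code_extend[OF C(1) R c \<delta>] C(2) n by (auto simp: \<rho>_def)
  qed
  then obtain C where "spherical_code n R c C" "card C = K" by blast
  moreover have "real K \<ge> 1 / (2 * \<rho> ^ n)"
    by (simp add: K_def) linarith
  ultimately show ?thesis using that by (simp add: \<rho>_def)
qed

section \<open>Average radius\<close>

text \<open>Mean squared norm minus squared norm of the centroid; the latter is expanded as a double
  sum that includes the diagonal.\<close>

lemma avg_rad_sq_eq:
  assumes S: "finite S" "S \<noteq> {}"
  shows "avg_rad_sq n S = (\<Sum>x\<in>S. \<Sum>i<n. (x i)\<^sup>2) / real (card S)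
           - (\<Sum>x\<in>S. \<Sum>y\<in>S. \<Sum>i<n. x i * y i) / (real (card S))\<^sup>2"
proof -
  let ?k = "real (card S)"
  let ?m = "centroid S"
  have k: "?k > 0" using S by (simp add: card_gt_0_iff)
  have sum_m: "(\<Sum>x\<in>S. x i) = ?k * ?m i" for i
    using k by (simp add: centroid_def)
  have "(\<Sum>x\<in>S. \<Sum>i<n. (x i - ?m i)\<^sup>2) = (\<Sum>i<n. \<Sum>x\<in>S. (x i - ?m i)\<^sup>2)"
    by (rule sum.swap)
  also have "\<dots> = (\<Sum>i<n. (\<Sum>x\<in>S. (x i)\<^sup>2) - ?k * (?m i)\<^sup>2)"
  proof (intro sum.cong refl)
    fix i
    have "(\<Sum>x\<in>S. (x i - ?m i)\<^sup>2) = (\<Sum>x\<in>S. (x i)\<^sup>2 - 2 * ?m i * x i + (?m i)\<^sup>2)"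
      by (intro sum.cong) (auto simp: power2_eq_square algebra_simps)
    also have "\<dots> = (\<Sum>x\<in>S. (x i)\<^sup>2) - 2 * ?m i * (\<Sum>x\<in>S. x i) + ?k * (?m i)\<^sup>2"
      by (simp add: sum.distrib sum_subtractf flip: sum_distrib_left)
    also have "\<dots> = (\<Sum>x\<in>S. (x i)\<^sup>2) - ?k * (?m i)\<^sup>2"
      by (simp add: sum_m power2_eq_square)
    finally show "(\<Sum>x\<in>S. (x i - ?m i)\<^sup>2) = (\<Sum>x\<in>S. (x i)\<^sup>2) - ?k * (?m i)\<^sup>2" .
  qed
  also have "\<dots> = (\<Sum>x\<in>S. \<Sum>i<n. (x i)\<^sup>2) - ?k * (\<Sum>i<n. (?m i)\<^sup>2)"
    by (simp add: sum_subtractf sum_distrib_left sum.swap[of _ "{..<n}" S])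
  finally have 1: "(\<Sum>x\<in>S. \<Sum>i<n. (x i - ?m i)\<^sup>2)
      = (\<Sum>x\<in>S. \<Sum>i<n. (x i)\<^sup>2) - ?k * (\<Sum>i<n. (?m i)\<^sup>2)" .
  have "(\<Sum>x\<in>S. \<Sum>y\<in>S. \<Sum>i<n. x i * y i) = (\<Sum>x\<in>S. \<Sum>i<n. \<Sum>y\<in>S. x i * y i)"
    by (intro sum.cong refl sum.swap)
  also have "\<dots> = (\<Sum>i<n. \<Sum>x\<in>S. \<Sum>y\<in>S. x i * y i)"
    by (rule sum.swap)
  also have "\<dots> = (\<Sum>i<n. (\<Sum>x\<in>S. x i) * (\<Sum>y\<in>S. y i))"
    by (simp add: sum_product)
  also have "\<dots> = ?k\<^sup>2 * (\<Sum>i<n. (?m i)\<^sup>2)"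
    by (simp add: sum_m sum_distrib_left power2_eq_square mult_ac)
  finally have 2: "(\<Sum>x\<in>S. \<Sum>y\<in>S. \<Sum>i<n. x i * y i) = ?k\<^sup>2 * (\<Sum>i<n. (?m i)\<^sup>2)" .
  show ?thesis
    unfolding avg_rad_sq_def 1 2 using k by (simp add: diff_divide_distrib power2_eq_square)
qed

text \<open>In each row of the Gram matrix of \<open>S\<close> the diagonal entry is
  \<open>R\<^sup>2\<close> and the other \<open>L - 1\<close> entries are below
  \<open>c * R\<^sup>2\<close>. Strictness survives summation because \<open>L \<ge> 2\<close>
  leaves at least one off-diagonal entry.\<close>

lemma avg_rad_sq_spherical_code:
  assumes C: "spherical_code n R c C" and S: "S \<subseteq> C" "card S = L" and L: "L \<ge> 2"
  shows "avg_rad_sq n S > (real L - 1) / real L * (1 - c) * R\<^sup>2"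
proof -
  have fin: "finite S"
    using C S by (auto simp: spherical_code_def intro: finite_subset)
  have "S \<noteq> {}" using S L by auto
  have norm: "(\<Sum>i<n. (x i)\<^sup>2) = R\<^sup>2" if "x \<in> S" for x
    using C S that by (auto simp: spherical_code_def)
  have row: "(\<Sum>y\<in>S. \<Sum>i<n. x i * y i) < R\<^sup>2 + (real L - 1) * (c * R\<^sup>2)" if x: "x \<in> S" for x
  proof -
    have "card (S - {x}) = L - 1" using x S fin by simp
    moreover from this have "S - {x} \<noteq> {}" using L by force
    moreover have "(\<Sum>i<n. x i * y i) < c * R\<^sup>2" if "y \<in> S - {x}" for y
    proof -
      have "x \<in> C" "y \<in> C" "x \<noteq> y" using S x that by auto
      then show ?thesis using C by (simp add: spherical_code_def)
    qed
    ultimately have "(\<Sum>y\<in>S - {x}. \<Sum>i<n. x i * y i) < (\<Sum>y\<in>S - {x}. c * R\<^sup>2)"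
      using fin by (intro sum_strict_mono) auto
    also have "\<dots> = (real L - 1) * (c * R\<^sup>2)"
      using \<open>card (S - {x}) = L - 1\<close> L by (simp only: sum_constant) (simp add: of_nat_diff)
    finally show ?thesis
      using norm[OF x] by (subst sum.remove[OF fin x]) (simp add: power2_eq_square)
  qed
  have "(\<Sum>x\<in>S. \<Sum>y\<in>S. \<Sum>i<n. x i * y i) < (\<Sum>x\<in>S. R\<^sup>2 + (real L - 1) * (c * R\<^sup>2))"
    using fin \<open>S \<noteq> {}\<close> row by (intro sum_strict_mono) auto
  also have "\<dots> = real L * (R\<^sup>2 + (real L - 1) * (c * R\<^sup>2))"
    using S by simp
  finally have "(\<Sum>x\<in>S. \<Sum>y\<in>S. \<Sum>i<n. x i * y i) / (real L)\<^sup>2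
      < real L * (R\<^sup>2 + (real L - 1) * (c * R\<^sup>2)) / (real L)\<^sup>2"
    using L by (intro divide_strict_right_mono) auto
  also have "\<dots> = R\<^sup>2 - (real L - 1) / real L * (1 - c) * R\<^sup>2"
    using L by (simp add: field_simps power2_eq_square)
  finally show ?thesis
    using avg_rad_sq_eq[OF fin \<open>S \<noteq> {}\<close>, of n] S L norm by simp
qed

section \<open>The capacity bound\<close>

text \<open>For fixed \<open>\<delta>\<close> the greedy codes exist for all large \<open>n\<close>.
  The factor 2 in their size bound costs only \<open>ln 2 / n\<close> in rate, which vanishes in the
  limit, so even the liminf satisfies the bound.\<close>

lemma list_dec_capacity_ge_spherical:
  assumes L: "L \<ge> 2" and P: "P > 0" and c: "0 \<le> c" "c < 1" and \<delta>: "0 < \<delta>" "\<delta> < 1"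
  shows "list_dec_capacity L P ((real L - 1) / real L * (1 - c) * P)
           \<ge> ereal (- (1 / 2) * ln (1 - c\<^sup>2 + \<delta>))"
proof -
  define N where "N = (real L - 1) / real L * (1 - c) * P"
  define s where "s = 1 - c\<^sup>2 + \<delta>"
  let ?u = "\<lambda>n. SUP C\<in>{C. C \<noteq> {} \<and> avg_radius_list_decodable n P N L C}. ereal (code_rate n C)"
  let ?v = "\<lambda>n. - (1 / 2) * ln s - ln 2 / real n"
  have "c\<^sup>2 < 1" using c by (simp add: power_less_one_iff)
  then have s: "s > 0" using \<delta> by (simp add: s_def)
  have "(\<lambda>n. (1 - \<delta>) ^ n) \<longlonglongrightarrow> 0"
    using \<delta> by (intro LIMSEQ_power_zero) auto
  then have "eventually (\<lambda>n. (1 - \<delta>) ^ n < 1 / 2) sequentially"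
    by (rule order_tendstoD) simp
  then have "eventually (\<lambda>n. ereal (?v n) \<le> ?u n) sequentially"
    using eventually_gt_at_top[of 0]
  proof eventually_elim
    case (elim n)
    define R where "R = sqrt (real n * P)"
    have R: "R > 0" "R\<^sup>2 = real n * P" using elim P by (simp_all add: R_def)
    obtain C where C: "spherical_code n R c C" and card: "real (card C) \<ge> 1 / (2 * sqrt s ^ n)"
      using exists_large_spherical_code[OF R(1) c \<delta>, of n] elim by (auto simp: s_def)
    have pos: "1 / (2 * sqrt s ^ n) > 0" using s by simp
    then have "C \<noteq> {}" using card by auto
    moreover have "avg_radius_list_decodable n P N L C"
      unfolding avg_radius_list_decodable_def
    proof (intro conjI ballI allI impI)
      show "finite C" "\<And>x. x \<in> C \<Longrightarrow> in_ball n (sqrt (real n * P)) x"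
        using C by (auto simp: spherical_code_def in_ball_def simp flip: R_def)
      show "avg_rad_sq n S > real n * N" if "S \<subseteq> C" "card S = L" for S
        using avg_rad_sq_spherical_code[OF C that L] by (simp add: N_def R mult_ac)
    qed
    moreover have "?v n \<le> code_rate n C"
    proof -
      have "real n * ?v n = ln (1 / (2 * sqrt s ^ n))"
        using s elim by (simp add: ln_div ln_mult ln_realpow ln_sqrt algebra_simps)
      also have "\<dots> \<le> ln (real (card C))"
        using card pos by (intro ln_mono)
      finally show ?thesis
        using elim by (simp add: code_rate_def pos_le_divide_eq mult.commute)
    qed
    ultimately show ?case by (intro SUP_upper2[of C]) auto
  qed
  then have "liminf (\<lambda>n. ereal (?v n)) \<le> liminf ?u"
    by (rule Liminf_mono)
  also have "\<dots> \<le> limsup ?u"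
    by (rule Liminf_le_Limsup) simp
  finally have "liminf (\<lambda>n. ereal (?v n)) \<le> list_dec_capacity L P N"
    by (simp add: list_dec_capacity_def)
  moreover have "?v \<longlonglongrightarrow> - (1 / 2) * ln s - 0"
    by (intro tendsto_diff tendsto_const lim_const_over_n)
  then have "liminf (\<lambda>n. ereal (?v n)) = ereal (- (1 / 2) * ln s)"
    by (intro lim_imp_Liminf) auto
  ultimately show ?thesis by (simp add: N_def s_def)
qed

theorem mainTheorem11:
  fixes L :: nat and P N :: real
  assumes "L \<ge> 2" and "P > 0" and "N > 0"
    and "N \<le> (real L - 1) / real L * P"
  shows "list_dec_capacity L P N \<ge>
    ereal (1/2 * ln ((real L - 1)\<^sup>2 * P\<^sup>2 /
                     (real L * N * (2 * (real L - 1) * P - real L * N))))"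
proof -
  \<comment> \<open>This \<open>c\<close> solves \<open>(L - 1) / L * (1 - c) * P = N\<close>. The
    upper bound on \<open>N\<close> gives \<open>0 \<le> c\<close>, and \<open>N > 0\<close> gives
    \<open>c < 1\<close>.\<close>
  define c where "c = 1 - real L * N / ((real L - 1) * P)"
  have L1: "real L - 1 > 0" using assms by simp
  have c: "0 \<le> c" "c < 1"
    using assms L1 by (simp_all add: c_def field_simps)
  have N: "(real L - 1) / real L * (1 - c) * P = N"
    using assms L1 by (simp add: c_def)
  have c2: "1 - c\<^sup>2 > 0" using c by (simp add: power_less_one_iff)
  have "1 - c\<^sup>2 = real L * N * (2 * (real L - 1) * P - real L * N) / ((real L - 1)\<^sup>2 * P\<^sup>2)"
    using assms L1 by (simp add: c_def power2_eq_square divide_simps) (simp add: algebra_simps)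
  then have arg: "(real L - 1)\<^sup>2 * P\<^sup>2 / (real L * N * (2 * (real L - 1) * P - real L * N))
      = 1 / (1 - c\<^sup>2)"
    by simp
  \<comment> \<open>The slack \<open>\<delta>\<close> is now sent to 0 from the right;
    \<open>ln\<close> is continuous at the limit because \<open>1 - c\<^sup>2 > 0\<close>.\<close>
  have "((\<lambda>\<delta>. - (1 / 2) * ln (1 - c\<^sup>2 + \<delta>)) \<longlongrightarrow> - (1 / 2) * ln (1 - c\<^sup>2 + 0)) (at_right 0)"
    using c2 by (intro tendsto_intros) auto
  then have lim: "((\<lambda>\<delta>. ereal (- (1 / 2) * ln (1 - c\<^sup>2 + \<delta>)))
      \<longlongrightarrow> ereal (1 / 2 * ln (1 / (1 - c\<^sup>2)))) (at_right 0)"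
    using c2 by (simp add: ln_div)
  have "eventually (\<lambda>\<delta>. ereal (- (1 / 2) * ln (1 - c\<^sup>2 + \<delta>)) \<le> list_dec_capacity L P N) (at_right 0)"
    using list_dec_capacity_ge_spherical[OF assms(1,2) c] N
    by (auto simp: eventually_at_right_field intro!: exI[of _ 1])
  then have "ereal (1 / 2 * ln (1 / (1 - c\<^sup>2))) \<le> list_dec_capacity L P N"
    by (intro tendsto_upperbound[OF lim]) auto
  then show ?thesis by (simp only: arg)
qed

end
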